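(* Let $\mathbb{F}_3$ be the field with three elements and let $C_3$ be a constant such that, for all families $\mathcal{L}_1,\mathcal{L}_2,\mathcal{L}_3$ of lines in $\mathbb{F}_3^3$ and all nonnegative coefficients $(a_{l_j})_{l_j\in\mathcal{L}_j}$, $j=1,2,3$, $$\sum_{x\in\mathbb{F}_3^3}\left(\sum_{l_1\in\mathcal{L}_1}\sum_{l_2\in\mathcal{L}_2}\sum_{l_3\in\mathcal{L}_3}a_{l_1}\chi_{l_1}(x)\,a_{l_2}\chi_{l_2}(x)\,a_{l_3}\chi_{l_3}(x)\;e(l_1)\wedge e(l_2)\wedge e(l_3)\right)^{1/2}\le C_3\prod_{j=1}^3\left(\sum_{l_j\in\mathcal{L}_j}a_{l_j}\right)^{1/2}.$$ Then $C_3>1.04$.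
   Context: Lines in $\mathbb{F}_3^3$ are affine lines; $\chi_l$ is the indicator function of the line $l$; $e(l)$ denotes a direction vector of $l$. The quantity $e(l_1)\wedge e(l_2)\wedge e(l_3)$ is declared to be the real number $1$ if the direction vectors $e(l_1),e(l_2),e(l_3)$ are linearly independent over $\mathbb{F}_3$, and $0$ otherwise. *)

theory Defs
  imports "HOL-Analysis.Analysis"
begin

definition is_direction :: "('k::field ^ 3) set \<Rightarrow> 'k ^ 3 \<Rightarrow> bool" where
  "is_direction l v \<longleftrightarrow> v \<noteq> 0 \<and> (\<exists>p. l = range (\<lambda>t. p + t *s v))"

definition affine_line :: "('k::field ^ 3) set \<Rightarrow> bool" where
  "affine_line l \<longleftrightarrow> (\<exists>v. is_direction l v)"

(* A choice of direction vector; any two differ by a nonzero scalar, so the wedge of three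
   of them does not depend on the choice. *)
definition direction :: "('k::field ^ 3) set \<Rightarrow> 'k ^ 3" where
  "direction l = (SOME v. is_direction l v)"

(* Linear independence is that of the family u, v, w; vec.independent refers to sets, in which
   repeated vectors would be identified, whence the distinctness condition. *)
definition wedge3 :: "'k::field ^ 3 \<Rightarrow> 'k ^ 3 \<Rightarrow> 'k ^ 3 \<Rightarrow> real" where
  "wedge3 u v w = (if distinct [u, v, w] \<and> vec.independent {u, v, w} then 1 else 0)"

end

theory Submission
  imports Defs
begin

text \<open>
  Take a tetrahedron. Its six edges split into three pairs of opposite
  edges; let the j-th family be the j-th pair, with all coefficients equal to 1. Each of the four
  vertices lies on one edge of each pair, and the three edges at a vertex have independent
  directions, so every vertex contributes at least 1 to the left-hand side, which is therefore at
  least 4. On the right-hand side each family has total mass 2, which gives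
  \<open>2 * sqrt 2\<close> times the constant. Hence the constant is at least
  \<open>sqrt 2\<close>.

  The Klein four-group of double transpositions of the vertices acts transitively on the vertices
  and preserves each pair of opposite edges. It reduces the count at an arbitrary
  vertex (\<open>tetrahedron_sum_ge_4\<close>) to the count at one vertex
  (\<open>tetrahedron_wedge3\<close>, \<open>sqrt_trilinear_sum_ge_1\<close>).
\<close>

section \<open>Lines through two points\<close>

definition join :: "'k::field ^ 3 \<Rightarrow> 'k ^ 3 \<Rightarrow> ('k ^ 3) set" where
  "join p q = range (\<lambda>t. p + t *s (q - p))"

lemma mem_join_left [simp]: "p \<in> join p q"
  unfolding join_def by (rule range_eqI[of _ _ 0]) simp

lemma join_commute: "join p q = join q p"
proof -
  have "join p q \<subseteq> join q p" for p q :: "'k::field ^ 3"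
  proof
    fix x assume "x \<in> join p q"
    then obtain t where "x = p + t *s (q - p)"
      by (auto simp: join_def)
    then have "x = q + (1 - t) *s (p - q)"
      by (simp add: vec_eq_iff algebra_simps)
    then show "x \<in> join q p"
      unfolding join_def by blast
  qed
  then show ?thesis by blast
qed

lemma affine_line_join: "p \<noteq> q \<Longrightarrow> affine_line (join p q)"
  unfolding affine_line_def is_direction_def join_def
  by (rule exI[of _ "q - p"]) auto

text \<open>The chosen direction is known only up to a nonzero scalar.\<close>

lemma direction_join:
  assumes "p \<noteq> q"
  obtains c where "c \<noteq> 0" "direction (join p q) = c *s (q - p)"
proof -
  define w where "w = direction (join p q)"
  have "is_direction (join p q) w"
    using affine_line_join[OF assms] unfolding affine_line_def direction_def w_def
    by (rule someI_ex)
  then obtain r where r: "join p q = range (\<lambda>t. r + t *s w)"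
    by (auto simp: is_direction_def)
  have "p \<in> join p q" "q \<in> join p q"
    using mem_join_left[of q p] by (simp_all add: join_commute)
  then obtain s t where st: "p = r + s *s w" "q = r + t *s w"
    unfolding r by blast
  then have q_p: "q - p = (t - s) *s w"
    by (simp add: vec.scale_left_diff_distrib)
  with assms have "t - s \<noteq> 0" by auto
  then have "w = inverse (t - s) *s (q - p)" and "inverse (t - s) \<noteq> 0"
    by (simp_all only: q_p vec.scale_scale left_inverse vec.scale_one
        nonzero_imp_inverse_nonzero not_False_eq_True)
  with that show ?thesis unfolding w_def by blast
qed

section \<open>Tetrahedra\<close>

text \<open>Independence as a statement about coefficients, so that it refers to the family
  \<open>u, v, w\<close> and repeated vectors need no separate treatment.\<close>

definition independent3 :: "'k::field ^ 3 \<Rightarrow> 'k ^ 3 \<Rightarrow> 'k ^ 3 \<Rightarrow> bool" where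
  "independent3 u v w \<longleftrightarrow>
     (\<forall>a b c. a *s u + b *s v + c *s w = 0 \<longrightarrow> a = 0 \<and> b = 0 \<and> c = 0)"

lemma independent3D:
  assumes "independent3 u v w" "a *s u + b *s v + c *s w = 0"
  shows "a = 0" "b = 0" "c = 0"
  using assms unfolding independent3_def by blast+

lemma wedge3_eq_1:
  assumes "independent3 u v w"
  shows "wedge3 u v w = 1"
proof -
  have "u \<noteq> v" using independent3D(1)[OF assms, of 1 "-1" 0] by auto
  moreover have "u \<noteq> w" using independent3D(1)[OF assms, of 1 0 "-1"] by auto
  moreover have "v \<noteq> w" using independent3D(2)[OF assms, of 0 1 "-1"] by auto
  ultimately have dist: "u \<noteq> v" "u \<noteq> w" "v \<noteq> w" by auto
  have "vec.independent {u, v, w}"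
  proof
    assume "vec.dependent {u, v, w}"
    then obtain f where f: "\<exists>x\<in>{u, v, w}. f x \<noteq> 0" "(\<Sum>x\<in>{u, v, w}. f x *s x) = 0"
      by (auto simp: vec.dependent_finite)
    then have "f u *s u + f v *s v + f w *s w = 0"
      using dist by (simp add: add.assoc)
    with f(1) independent3D[OF assms] show False by blast
  qed
  with dist show ?thesis by (simp add: wedge3_def)
qed

lemma independent3_scale:
  assumes "independent3 u v w" "c \<noteq> 0" "d \<noteq> 0" "e \<noteq> 0"
  shows "independent3 (c *s u) (d *s v) (e *s w)"
  using assms unfolding independent3_def by (simp add: vec.scale_scale) (metis mult_eq_0_iff)

definition tetrahedron :: "'k::field ^ 3 \<Rightarrow> 'k ^ 3 \<Rightarrow> 'k ^ 3 \<Rightarrow> 'k ^ 3 \<Rightarrow> bool" where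
  "tetrahedron p q r s \<longleftrightarrow> independent3 (q - p) (r - p) (s - p)"

text \<open>The following two double transpositions generate the Klein four-group.\<close>

lemma tetrahedron_swap12_34:
  assumes "tetrahedron p q r s"
  shows "tetrahedron q p s r"
  unfolding tetrahedron_def independent3_def
proof (intro allI impI)
  fix a b c assume "a *s (p - q) + b *s (s - q) + c *s (r - q) = 0"
  then have "(- a - b - c) *s (q - p) + c *s (r - p) + b *s (s - p) = 0"
    by (simp add: vec_eq_iff algebra_simps)
  from independent3D[OF assms[unfolded tetrahedron_def] this]
  show "a = 0 \<and> b = 0 \<and> c = 0" by simp
qed

lemma tetrahedron_swap13_24:
  assumes "tetrahedron p q r s"
  shows "tetrahedron r s p q"
  unfolding tetrahedron_def independent3_def
proof (intro allI impI)
  fix a b c assume "a *s (s - r) + b *s (p - r) + c *s (q - r) = 0"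
  then have "c *s (q - p) + (- a - b - c) *s (r - p) + a *s (s - p) = 0"
    by (simp add: vec_eq_iff algebra_simps)
  from independent3D[OF assms[unfolded tetrahedron_def] this]
  show "a = 0 \<and> b = 0 \<and> c = 0" by simp
qed

lemma tetrahedron_first_vertex_distinct:
  assumes "tetrahedron p q r s"
  shows "p \<noteq> q" "p \<noteq> r" "p \<noteq> s"
  using independent3D(1)[OF assms[unfolded tetrahedron_def], of 1 0 0]
    independent3D(2)[OF assms[unfolded tetrahedron_def], of 0 1 0]
    independent3D(3)[OF assms[unfolded tetrahedron_def], of 0 0 1] by auto

lemma tetrahedron_distinct:
  assumes "tetrahedron p q r s"
  shows "distinct [p, q, r, s]"
  using tetrahedron_first_vertex_distinct[OF assms]
    tetrahedron_first_vertex_distinct[OF tetrahedron_swap12_34[OF assms]]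
    tetrahedron_first_vertex_distinct[OF tetrahedron_swap13_24[OF assms]] by auto

lemma tetrahedron_wedge3:
  assumes "tetrahedron p q r s"
  shows "wedge3 (direction (join p q)) (direction (join p r)) (direction (join p s)) = 1"
proof -
  note neq = tetrahedron_first_vertex_distinct[OF assms]
  obtain c where c: "c \<noteq> 0" "direction (join p q) = c *s (q - p)"
    using direction_join[OF neq(1)] .
  obtain d where d: "d \<noteq> 0" "direction (join p r) = d *s (r - p)"
    using direction_join[OF neq(2)] .
  obtain e where e: "e \<noteq> 0" "direction (join p s) = e *s (s - p)"
    using direction_join[OF neq(3)] .
  show ?thesis
    using assms unfolding tetrahedron_def c(2) d(2) e(2)
    by (intro wedge3_eq_1 independent3_scale c(1) d(1) e(1))
qed

lemma tetrahedron_standard: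
  "tetrahedron (0 :: 'k::field ^ 3) (axis 1 1) (axis 2 1) (axis 3 1)"
  by (simp add: tetrahedron_def independent3_def vec_eq_iff forall_3 axis_def)

section \<open>The sum over the vertices\<close>

text \<open>The coefficients are all 1; a single transversal triple of lines through
  \<open>x\<close> already contributes 1, and all other terms are nonnegative.\<close>

lemma sqrt_trilinear_sum_ge_1:
  fixes L\<^sub>1 L\<^sub>2 L\<^sub>3 :: "('k::field ^ 3) set set"
  assumes fin: "finite L\<^sub>1" "finite L\<^sub>2" "finite L\<^sub>3"
    and mem: "l \<in> L\<^sub>1" "m \<in> L\<^sub>2" "n \<in> L\<^sub>3"
    and x: "x \<in> l" "x \<in> m" "x \<in> n"
    and wedge: "wedge3 (direction l) (direction m) (direction n) = 1"
  shows "1 \<le> sqrt (\<Sum>l\<^sub>1\<in>L\<^sub>1. \<Sum>l\<^sub>2\<in>L\<^sub>2. \<Sum>l\<^sub>3\<in>L\<^sub>3.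
            1 * indicator l\<^sub>1 x * (1 * indicator l\<^sub>2 x) * (1 * indicator l\<^sub>3 x)
            * wedge3 (direction l\<^sub>1) (direction l\<^sub>2) (direction l\<^sub>3))"
    (is "1 \<le> sqrt (\<Sum>l\<^sub>1\<in>L\<^sub>1. \<Sum>l\<^sub>2\<in>L\<^sub>2. \<Sum>l\<^sub>3\<in>L\<^sub>3. ?f l\<^sub>1 l\<^sub>2 l\<^sub>3)")
proof -
  have nonneg: "0 \<le> ?f l\<^sub>1 l\<^sub>2 l\<^sub>3" for l\<^sub>1 l\<^sub>2 l\<^sub>3
    by (simp add: wedge3_def)
  have "1 = ?f l m n"
    using x wedge by simp
  also have "\<dots> \<le> (\<Sum>l\<^sub>3\<in>L\<^sub>3. ?f l m l\<^sub>3)"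
    using mem(3) nonneg fin(3) by (rule member_le_sum)
  also have "\<dots> \<le> (\<Sum>l\<^sub>2\<in>L\<^sub>2. \<Sum>l\<^sub>3\<in>L\<^sub>3. ?f l l\<^sub>2 l\<^sub>3)"
    by (rule member_le_sum[of m _ "\<lambda>l\<^sub>2. \<Sum>l\<^sub>3\<in>L\<^sub>3. ?f l l\<^sub>2 l\<^sub>3"]) (intro mem fin sum_nonneg nonneg)+
  also have "\<dots> \<le> (\<Sum>l\<^sub>1\<in>L\<^sub>1. \<Sum>l\<^sub>2\<in>L\<^sub>2. \<Sum>l\<^sub>3\<in>L\<^sub>3. ?f l\<^sub>1 l\<^sub>2 l\<^sub>3)"
    by (rule member_le_sum[of l _ "\<lambda>l\<^sub>1. \<Sum>l\<^sub>2\<in>L\<^sub>2. \<Sum>l\<^sub>3\<in>L\<^sub>3. ?f l\<^sub>1 l\<^sub>2 l\<^sub>3"])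
      (intro mem fin sum_nonneg nonneg)+
  finally show ?thesis by simp
qed

lemma tetrahedron_sum_ge_4:
  fixes p q r s :: "'k::{field,finite} ^ 3"
  assumes pqrs: "tetrahedron p q r s"
  shows "4 \<le> (\<Sum>x\<in>UNIV. sqrt (\<Sum>l\<^sub>1\<in>{join p q, join r s}. \<Sum>l\<^sub>2\<in>{join p r, join q s}.
            \<Sum>l\<^sub>3\<in>{join p s, join q r}.
            1 * indicator l\<^sub>1 x * (1 * indicator l\<^sub>2 x) * (1 * indicator l\<^sub>3 x)
            * wedge3 (direction l\<^sub>1) (direction l\<^sub>2) (direction l\<^sub>3)))"
    (is "4 \<le> (\<Sum>x\<in>UNIV. ?F x)")
proof -
  define F where "F x = ?F x" for x
  \<comment> \<open>Under each double transposition the three pairs of edges are the same up to the order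
    of the edges in a pair and of the points on an edge.\<close>
  have vertex: "1 \<le> F a"
    if t: "tetrahedron a b c d"
      and edges: "join a b \<in> {join p q, join r s}" "join a c \<in> {join p r, join q s}"
        "join a d \<in> {join p s, join q r}" for a b c d
    unfolding F_def
    by (rule sqrt_trilinear_sum_ge_1[OF _ _ _ edges _ _ _ tetrahedron_wedge3[OF t]]) simp_all
  note qpsr = tetrahedron_swap12_34[OF pqrs]
  note rspq = tetrahedron_swap13_24[OF pqrs]
  note srqp = tetrahedron_swap12_34[OF rspq]
  have "1 \<le> F p" by (rule vertex[OF pqrs]) simp_all
  moreover have "1 \<le> F q" by (rule vertex[OF qpsr]) (simp_all add: join_commute)
  moreover have "1 \<le> F r" by (rule vertex[OF rspq]) (simp_all add: join_commute)
  moreover have "1 \<le> F s" by (rule vertex[OF srqp]) (simp_all add: join_commute)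
  ultimately have "of_nat (card {p, q, r, s}) * 1 \<le> (\<Sum>x\<in>{p, q, r, s}. F x)"
    by (intro sum_bounded_below) auto
  moreover have "card {p, q, r, s} = 4"
    using tetrahedron_distinct[OF pqrs] by simp
  moreover have "(\<Sum>x\<in>{p, q, r, s}. F x) \<le> (\<Sum>x\<in>UNIV. F x)"
    unfolding F_def
    by (intro sum_mono2 real_sqrt_ge_zero sum_nonneg) (auto simp: wedge3_def)
  ultimately have "4 \<le> (\<Sum>x\<in>UNIV. F x)" by simp
  then show ?thesis unfolding F_def .
qed

theorem proposition11p2:
  fixes C\<^sub>3 :: real
  assumes "CARD('k::{field,finite}) = 3"
    and "\<And>(L\<^sub>1 :: ('k ^ 3) set set) (L\<^sub>2 :: ('k ^ 3) set set) (L\<^sub>3 :: ('k ^ 3) set set)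
           (a\<^sub>1 :: ('k ^ 3) set \<Rightarrow> real) (a\<^sub>2 :: ('k ^ 3) set \<Rightarrow> real) (a\<^sub>3 :: ('k ^ 3) set \<Rightarrow> real).
         \<lbrakk>\<forall>l\<in>L\<^sub>1. affine_line l; \<forall>l\<in>L\<^sub>2. affine_line l; \<forall>l\<in>L\<^sub>3. affine_line l;
          \<forall>l\<in>L\<^sub>1. 0 \<le> a\<^sub>1 l; \<forall>l\<in>L\<^sub>2. 0 \<le> a\<^sub>2 l; \<forall>l\<in>L\<^sub>3. 0 \<le> a\<^sub>3 l\<rbrakk> \<Longrightarrow>
         (\<Sum>x\<in>UNIV. sqrt (\<Sum>l\<^sub>1\<in>L\<^sub>1. \<Sum>l\<^sub>2\<in>L\<^sub>2. \<Sum>l\<^sub>3\<in>L\<^sub>3.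
            a\<^sub>1 l\<^sub>1 * indicator l\<^sub>1 x * (a\<^sub>2 l\<^sub>2 * indicator l\<^sub>2 x) * (a\<^sub>3 l\<^sub>3 * indicator l\<^sub>3 x)
            * wedge3 (direction l\<^sub>1) (direction l\<^sub>2) (direction l\<^sub>3)))
         \<le> C\<^sub>3 * (sqrt (\<Sum>l\<^sub>1\<in>L\<^sub>1. a\<^sub>1 l\<^sub>1) * sqrt (\<Sum>l\<^sub>2\<in>L\<^sub>2. a\<^sub>2 l\<^sub>2) * sqrt (\<Sum>l\<^sub>3\<in>L\<^sub>3. a\<^sub>3 l\<^sub>3))"
  shows "C\<^sub>3 > 1.04"
proof -
  let ?p = "0 :: 'k ^ 3" and ?q = "axis 1 1 :: 'k ^ 3"
    and ?r = "axis 2 1 :: 'k ^ 3" and ?s = "axis 3 1 :: 'k ^ 3"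
  let ?L = "{join ?p ?q, join ?r ?s}" and ?M = "{join ?p ?r, join ?q ?s}"
    and ?N = "{join ?p ?s, join ?q ?r}"
  let ?R = "sqrt (\<Sum>l\<in>?L. 1) * sqrt (\<Sum>l\<in>?M. 1) * sqrt (\<Sum>l\<in>?N. 1)"
  have dist: "distinct [?p, ?q, ?r, ?s]"
    by (rule tetrahedron_distinct[OF tetrahedron_standard])
  have lines: "\<forall>l\<in>?L. affine_line l" "\<forall>l\<in>?M. affine_line l" "\<forall>l\<in>?N. affine_line l"
    using dist by (auto intro: affine_line_join)
  have bound: "4 \<le> C\<^sub>3 * ?R"
    by (rule order_trans[OF tetrahedron_sum_ge_4[OF tetrahedron_standard]
          assms(2)[of ?L ?M ?N "\<lambda>_. 1" "\<lambda>_. 1" "\<lambda>_. 1", OF lines]]) simp_all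
  have mass: "sqrt (\<Sum>l\<in>{a, b}. 1) \<le> sqrt 2" for a b :: "('k ^ 3) set"
    by (simp add: card_insert_if del: sum.insert)
  have R: "?R \<le> sqrt 2 * sqrt 2 * sqrt 2"
    by (intro mult_mono mass) (simp_all add: sum_nonneg)
  have R0: "0 \<le> ?R"
    by (intro mult_nonneg_nonneg real_sqrt_ge_zero sum_nonneg) simp_all
  have "0 < C\<^sub>3"
  proof (rule ccontr)
    assume "\<not> 0 < C\<^sub>3"
    with R0 have "C\<^sub>3 * ?R \<le> 0" by (simp add: mult_nonpos_nonneg del: sum.insert)
    with bound show False by linarith
  qed
  with R have "C\<^sub>3 * ?R \<le> C\<^sub>3 * (sqrt 2 * sqrt 2 * sqrt 2)"
    by (intro mult_left_mono) simp_all
  with bound have "4 \<le> C\<^sub>3 * (2 * sqrt 2)" by simp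
  \<comment> \<open>Any rational bound for \<open>sqrt 2\<close> below \<open>2 / 1.04\<close> will do.\<close>
  moreover have "sqrt 2 < 1.9"
    by (rule real_less_lsqrt) (simp_all add: power2_eq_square)
  with \<open>0 < C\<^sub>3\<close> have "C\<^sub>3 * (2 * sqrt 2) < C\<^sub>3 * 3.8"
    by (intro mult_strict_left_mono) simp_all
  ultimately show "C\<^sub>3 > 1.04" by simp
qed

end
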